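(* For any basic instruction $S$, $\models\{p\}S\{q\}$ holds if and only if $\{p\}S\{q\}$ is derivable from the following axioms (with $y$ fresh everywhere, and $x$ not occurring in $e$ in the allocation axiom) together with a single application of the rule of consequence: \begin{itemize} \item $\{p\}\;x:=e\;\{\exists y([x:=y]p\wedge x=e[y/x])\}$; \item $\{p\wedge(e\hookrightarrow -)\}\;x:=[e]\;\{\exists y([x:=y]p\wedge (x\hookrightarrow e[y/x]))\}$; \item $\{p\wedge(x\hookrightarrow -)\}\;[x]:=e\;\{\exists y([\langle x\rangle:=y]p)\wedge(x\hookrightarrow e)\}$; \item $\{p\}\;x:=\mathbf{cons}(e)\;\{[\langle x\rangle:=\bot](\exists x\, p)\wedge(x\hookrightarrow e)\}$; \item $\{p\wedge(x\hookrightarrow -)\}\;\mathbf{dispose}(x)\;\{\exists y([\langle x\rangle:=y]p)\wedge\neg(x\hookrightarrow -)\}$. \end{itemize}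
   Context: Setting (Dynamic Separation Logic, DSL). Heaps $h$ are finitely-based partial functions $\mathbb{Z}\rightharpoonup\mathbb{Z}$, stores $s$ total functions from integer variables to $\mathbb{Z}$; expressions do not refer to the heap; $e[y/x]$ is substitution of $y$ for $x$. $h[n:=v]$ sets location $n$ to $v$; $h[n:=\bot]$ removes $n$ from the domain. Assertions include $(e\hookrightarrow e')$ (true iff $s(e)\in\mathrm{dom}(h)$ and $h(s(e))=s(e')$), $(e\hookrightarrow -)$ abbreviating $\exists z(e\hookrightarrow z)$, separation logic connectives, and modalities $[S]p$ (execution of $S$ does not fail and every final state satisfies $p$). Basic instructions: $x:=e$ gives $(h,s[x:=s(e)])$; $x:=[e]$ fails if $s(e)\notin\mathrm{dom}(h)$, else gives $(h,s[x:=h(s(e))])$; $[x]:=e$ fails if $s(x)\notin\mathrm{dom}(h)$, else gives $(h[s(x):=s(e)],s)$; $x:=\mathbf{cons}(e)$ gives $(h[n:=s(e)],s[x:=n])$ for some $n\notin\mathrm{dom}(h)$; $\mathbf{dispose}(x)$ fails if $s(x)\notin\mathrm{dom}(h)$, else gives $(h[s(x):=\bot],s)$. Pseudo-instructions (never failing): heap update $\langle x\rangle:=e$ gives $(h[s(x):=s(e)],s)$, heap clear $\langle x\rangle:=\bot$ gives $(h[s(x):=\bot],s)$. Validity $\models\{p\}S\{q\}$ (strong partial correctness): whenever $h,s\models p$, execution of $S$ from $(h,s)$ does not fail and every resulting $(h',s')$ satisfies $q$. Rule of consequence: from $\models p\to p'$, $\{p'\}S\{q'\}$ and $\models q'\to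 q$ derive $\{p\}S\{q\}$.
   Formalization: In the look-up axiom the conjunct (x ↪ e[y/x]) is corrected to (e[y/x] ↪ x), since the printed form is unsound; and for S = x:=cons(e) the equivalence is stated only when x does not occur in e, since otherwise valid triples are not derivable. *)

theory Defs
  imports "HOL-Library.Finite_Map"
begin

type_synonym var = nat
type_synonym store = "var \<Rightarrow> int"
type_synonym heap = "(int, int) fmap"

text \<open>
  The expression language is left open: it is built over an arbitrary first-order signature, with
  function symbols \<open>'f\<close> (constants are applied to the empty list) and relation symbols \<open>'r\<close>. Their
  meaning is given by the parameters \<open>F\<close> and \<open>R\<close> of the semantics below.
\<close>

datatype 'f exp = Var var | App 'f "'f exp list"

datatype ('f, 'r) bexp =
    BFalse
  | BEq "'f exp" "'f exp"
  | BRel 'r "'f exp list"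
  | BImp "('f, 'r) bexp" "('f, 'r) bexp"

datatype 'f instr =
    Assign var "'f exp"      (* x := e *)
  | Lookup var "'f exp"      (* x := [e] *)
  | Mutate var "'f exp"      (* [x] := e *)
  | Alloc var "'f exp"       (* x := cons(e) *)
  | Dispose var              (* dispose(x) *)
  | HUpdate var "'f exp"     (* pseudo-instruction <x> := e *)
  | HClear var               (* pseudo-instruction <x> := bottom *)

fun basic :: "'f instr \<Rightarrow> bool" where
  "basic (HUpdate x e) = False"
| "basic (HClear x) = False"
| "basic S = True"

datatype ('f, 'r) assn =
    ABool "('f, 'r) bexp"
  | APts "'f exp" "'f exp"  (infix "\<hookrightarrow>" 80)
  | AImp "('f, 'r) assn" "('f, 'r) assn"
  | AAll var "('f, 'r) assn"
  | ASep "('f, 'r) assn" "('f, 'r) assn"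
  | AWand "('f, 'r) assn" "('f, 'r) assn"
  | ABox "'f instr" "('f, 'r) assn"


primrec vars :: "'f exp \<Rightarrow> var set" where
  "vars (Var x) = {x}"
| "vars (App f es) = \<Union> (set (map vars es))"

primrec bvars :: "('f, 'r) bexp \<Rightarrow> var set" where
  "bvars BFalse = {}"
| "bvars (BEq e e') = vars e \<union> vars e'"
| "bvars (BRel r es) = \<Union> (set (map vars es))"
| "bvars (BImp b c) = bvars b \<union> bvars c"

primrec ivars :: "'f instr \<Rightarrow> var set" where
  "ivars (Assign x e) = insert x (vars e)"
| "ivars (Lookup x e) = insert x (vars e)"
| "ivars (Mutate x e) = insert x (vars e)"
| "ivars (Alloc x e) = insert x (vars e)"
| "ivars (Dispose x) = {x}"
| "ivars (HUpdate x e) = insert x (vars e)"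
| "ivars (HClear x) = {x}"

text \<open>All variables occurring in an assertion, free or bound.\<close>

primrec avars :: "('f, 'r) assn \<Rightarrow> var set" where
  "avars (ABool b) = bvars b"
| "avars (e \<hookrightarrow> e') = vars e \<union> vars e'"
| "avars (AImp p q) = avars p \<union> avars q"
| "avars (AAll x p) = insert x (avars p)"
| "avars (ASep p q) = avars p \<union> avars q"
| "avars (AWand p q) = avars p \<union> avars q"
| "avars (ABox S p) = ivars S \<union> avars p"

text \<open>\<open>subst e y x\<close> is e[y/x], the result of replacing the variable x by y in e.\<close>

primrec subst :: "'f exp \<Rightarrow> var \<Rightarrow> var \<Rightarrow> 'f exp" where
  "subst (Var z) y x = Var (if z = x then y else z)"
| "subst (App f es) y x = App f (map (\<lambda>e. subst e y x) es)"


definition ANot :: "('f, 'r) assn \<Rightarrow> ('f, 'r) assn" where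
  "ANot p = AImp p (ABool BFalse)"

definition AAnd :: "('f, 'r) assn \<Rightarrow> ('f, 'r) assn \<Rightarrow> ('f, 'r) assn" where
  "AAnd p q = ANot (AImp p (ANot q))"

definition AEx :: "var \<Rightarrow> ('f, 'r) assn \<Rightarrow> ('f, 'r) assn" where
  "AEx x p = ANot (AAll x (ANot p))"

definition AEq :: "'f exp \<Rightarrow> 'f exp \<Rightarrow> ('f, 'r) assn" where
  "AEq e e' = ABool (BEq e e')"

text \<open>\<open>AAlloc e\<close> is \<open>e \<hookrightarrow> -\<close>; the bound variable must not be captured by e.\<close>

definition AAlloc :: "'f exp \<Rightarrow> ('f, 'r) assn" where
  "AAlloc e = (let z = (LEAST z. z \<notin> vars e) in AEx z (e \<hookrightarrow> Var z))"


primrec eval :: "('f \<Rightarrow> int list \<Rightarrow> int) \<Rightarrow> store \<Rightarrow> 'f exp \<Rightarrow> int" where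
  "eval F s (Var x) = s x"
| "eval F s (App f es) = F f (map (eval F s) es)"

primrec beval ::
  "('f \<Rightarrow> int list \<Rightarrow> int) \<Rightarrow> ('r \<Rightarrow> int list \<Rightarrow> bool) \<Rightarrow> store \<Rightarrow> ('f, 'r) bexp \<Rightarrow> bool" where
  "beval F R s BFalse = False"
| "beval F R s (BEq e e') = (eval F s e = eval F s e')"
| "beval F R s (BRel r es) = R r (map (eval F s) es)"
| "beval F R s (BImp b c) = (beval F R s b \<longrightarrow> beval F R s c)"

datatype outcome = Fail | Final heap store

inductive exec :: "('f \<Rightarrow> int list \<Rightarrow> int) \<Rightarrow> 'f instr \<Rightarrow> heap \<Rightarrow> store \<Rightarrow> outcome \<Rightarrow> bool"
  for F :: "'f \<Rightarrow> int list \<Rightarrow> int" where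
  Assign: "exec F (Assign x e) h s (Final h (s(x := eval F s e)))"
| Lookup: "fmlookup h (eval F s e) = Some v \<Longrightarrow> exec F (Lookup x e) h s (Final h (s(x := v)))"
| Lookup_Fail: "eval F s e |\<notin>| fmdom h \<Longrightarrow> exec F (Lookup x e) h s Fail"
| Mutate: "s x |\<in>| fmdom h \<Longrightarrow> exec F (Mutate x e) h s (Final (fmupd (s x) (eval F s e) h) s)"
| Mutate_Fail: "s x |\<notin>| fmdom h \<Longrightarrow> exec F (Mutate x e) h s Fail"
| Alloc: "n |\<notin>| fmdom h \<Longrightarrow>
    exec F (Alloc x e) h s (Final (fmupd n (eval F s e) h) (s(x := n)))"
| Dispose: "s x |\<in>| fmdom h \<Longrightarrow> exec F (Dispose x) h s (Final (fmdrop (s x) h) s)"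
| Dispose_Fail: "s x |\<notin>| fmdom h \<Longrightarrow> exec F (Dispose x) h s Fail"
| HUpdate: "exec F (HUpdate x e) h s (Final (fmupd (s x) (eval F s e) h) s)"
| HClear: "exec F (HClear x) h s (Final (fmdrop (s x) h) s)"

definition disjoint_heaps :: "heap \<Rightarrow> heap \<Rightarrow> bool" where
  "disjoint_heaps h h' \<longleftrightarrow> fmdom h |\<inter>| fmdom h' = {||}"

primrec sat ::
  "('f \<Rightarrow> int list \<Rightarrow> int) \<Rightarrow> ('r \<Rightarrow> int list \<Rightarrow> bool) \<Rightarrow> heap \<Rightarrow> store \<Rightarrow> ('f, 'r) assn \<Rightarrow> bool"
where
  "sat F R h s (ABool b) = beval F R s b"
| "sat F R h s (e \<hookrightarrow> e') = (fmlookup h (eval F s e) = Some (eval F s e'))"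
| "sat F R h s (AImp p q) = (sat F R h s p \<longrightarrow> sat F R h s q)"
| "sat F R h s (AAll x p) = (\<forall>n. sat F R h (s(x := n)) p)"
| "sat F R h s (ASep p q) =
    (\<exists>h1 h2. disjoint_heaps h1 h2 \<and> h = h1 ++\<^sub>f h2 \<and> sat F R h1 s p \<and> sat F R h2 s q)"
| "sat F R h s (AWand p q) =
    (\<forall>h'. disjoint_heaps h h' \<longrightarrow> sat F R h' s p \<longrightarrow> sat F R (h ++\<^sub>f h') s q)"
| "sat F R h s (ABox S p) =
    (\<not> exec F S h s Fail \<and> (\<forall>h' s'. exec F S h s (Final h' s') \<longrightarrow> sat F R h' s' p))"

definition valid ::
  "('f \<Rightarrow> int list \<Rightarrow> int) \<Rightarrow> ('r \<Rightarrow> int list \<Rightarrow> bool) \<Rightarrow> ('f, 'r) assn \<Rightarrow> bool" where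
  "valid F R p \<longleftrightarrow> (\<forall>h s. sat F R h s p)"

definition hoare_valid ::
  "('f \<Rightarrow> int list \<Rightarrow> int) \<Rightarrow> ('r \<Rightarrow> int list \<Rightarrow> bool) \<Rightarrow>
    ('f, 'r) assn \<Rightarrow> 'f instr \<Rightarrow> ('f, 'r) assn \<Rightarrow> bool" where
  "hoare_valid F R p S q \<longleftrightarrow>
    (\<forall>h s. sat F R h s p \<longrightarrow>
      \<not> exec F S h s Fail \<and> (\<forall>h' s'. exec F S h s (Final h' s') \<longrightarrow> sat F R h' s' q))"


text \<open>
  In \<open>Lookup\<close>, the final value of x is the content of the location denoted by e in the initial store,
  so the last conjunct is \<open>e[y/x] \<hookrightarrow> x\<close>. With the two sides exchanged, \<open>x \<hookrightarrow> e[y/x]\<close>, the axiom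
  would be unsound: from the heap with only location 0, containing 1, and a store with z = 0,
  the instruction x := [z] ends with x = 1, which is not allocated.
\<close>

inductive sp_axiom :: "('f, 'r) assn \<Rightarrow> 'f instr \<Rightarrow> ('f, 'r) assn \<Rightarrow> bool" where
  Assign: "y \<notin> insert x (vars e \<union> avars p) \<Longrightarrow>
    sp_axiom p (Assign x e)
      (AEx y (AAnd (ABox (Assign x (Var y)) p) (AEq (Var x) (subst e y x))))"
| Lookup: "y \<notin> insert x (vars e \<union> avars p) \<Longrightarrow>
    sp_axiom (AAnd p (AAlloc e)) (Lookup x e)
      (AEx y (AAnd (ABox (Assign x (Var y)) p) (subst e y x \<hookrightarrow> Var x)))"
| Mutate: "y \<notin> insert x (vars e \<union> avars p) \<Longrightarrow>
    sp_axiom (AAnd p (AAlloc (Var x))) (Mutate x e)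
      (AAnd (AEx y (ABox (HUpdate x (Var y)) p)) (Var x \<hookrightarrow> e))"
| Alloc: "x \<notin> vars e \<Longrightarrow>
    sp_axiom p (Alloc x e) (AAnd (ABox (HClear x) (AEx x p)) (Var x \<hookrightarrow> e))"
| Dispose: "y \<notin> insert x (avars p) \<Longrightarrow>
    sp_axiom (AAnd p (AAlloc (Var x))) (Dispose x)
      (AAnd (AEx y (ABox (HUpdate x (Var y)) p)) (ANot (AAlloc (Var x))))"

text \<open>Derivability from the axioms by a single application of the rule of consequence.\<close>

inductive derivable ::
  "('f \<Rightarrow> int list \<Rightarrow> int) \<Rightarrow> ('r \<Rightarrow> int list \<Rightarrow> bool) \<Rightarrow>
    ('f, 'r) assn \<Rightarrow> 'f instr \<Rightarrow> ('f, 'r) assn \<Rightarrow> bool"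
  for F R where
  consequence:
    "valid F R (AImp p p') \<Longrightarrow> sp_axiom p' S q' \<Longrightarrow> valid F R (AImp q' q) \<Longrightarrow> derivable F R p S q"

end

theory Submission
  imports Defs
begin

text \<open>
  The postcondition of an axiom describes exactly the final states reachable from its precondition:
  the fresh variable guesses the value that the instruction overwrites, so the initial state can be
  rebuilt from the final one. This gives soundness, and it makes that postcondition the strongest
  one, so that it entails any other valid one. Allocation needs no guess for the heap, since the
  location that it writes to was unallocated before.
\<close>

section \<open>Finiteness of variable sets and choice of fresh variables\<close>

lemma finite_vars: "finite (vars e)"
  by (induction e) auto

lemma finite_bvars: "finite (bvars b)"
  by (induction b) (auto simp: finite_vars)

lemma finite_ivars: "finite (ivars S)"
  by (cases S) (auto simp: finite_vars)

lemma finite_avars: "finite (avars p)"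
  by (induction p) (auto simp: finite_vars finite_bvars finite_ivars)

lemma ex_fresh:
  assumes "finite V"
  obtains y :: var where "y \<notin> V"
  using assms ex_new_if_finite infinite_UNIV_nat by blast

section \<open>Dependence of expressions on the store, and substitution\<close>

lemma eval_cong: "(\<And>x. x \<in> vars e \<Longrightarrow> s x = t x) \<Longrightarrow> eval F s e = eval F t e"
proof (induction e)
  case (App f es)
  then have "map (eval F s) es = map (eval F t) es"
    by auto
  then show ?case
    by (simp del: map_eq_conv)
qed simp

lemma eval_upd [simp]: "x \<notin> vars e \<Longrightarrow> eval F (s(x := v)) e = eval F s e"
  by (rule eval_cong) auto

lemma eval_subst: "eval F s (subst e y x) = eval F (s(x := s y)) e"
proof (induction e)
  case (App f es)
  then have "map (eval F s) (map (\<lambda>e. subst e y x) es) = map (eval F (s(x := s y))) es"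
    by (simp del: fun_upd_apply)
  then show ?case
    by (simp del: map_map map_eq_conv fun_upd_apply)
qed simp

text \<open>If \<open>y\<close> holds the guess \<open>n\<close> for the old value of
  \<open>x\<close>, then e[y/x], read in the final store, gives what \<open>e\<close> gave in the
  initial one.\<close>

lemma eval_subst_fresh:
  assumes "y \<notin> vars e"
  shows "eval F (s(y := n)) (subst e y x) = eval F (s(x := n)) e"
  using assms by (auto simp: eval_subst intro!: eval_cong)

lemma beval_cong:
  "(\<And>x. x \<in> bvars b \<Longrightarrow> s x = t x) \<Longrightarrow> beval F R s b = beval F R t b"
proof (induction b)
  case (BEq e e')
  then have "eval F s e = eval F t e" "eval F s e' = eval F t e'"
    by (auto intro!: eval_cong)
  then show ?case by simp
next
  case (BRel r es)
  then have "map (eval F s) es = map (eval F t) es"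
    by (auto intro!: eval_cong)
  then show ?case
    by (simp del: map_eq_conv)
qed auto

section \<open>Outcomes of each instruction in closed form\<close>

lemma exec_Assign_iff [simp]:
  "exec F (Assign x e) h s r \<longleftrightarrow> r = Final h (s(x := eval F s e))"
  by (auto elim!: exec.cases intro: exec.intros)

lemma exec_Lookup_iff [simp]:
  "exec F (Lookup x e) h s r \<longleftrightarrow>
    (case fmlookup h (eval F s e) of None \<Rightarrow> r = Fail | Some v \<Rightarrow> r = Final h (s(x := v)))"
  by (auto elim!: exec.cases intro: exec.intros split: option.splits simp: fmdom_notI)

lemma exec_Mutate_iff [simp]:
  "exec F (Mutate x e) h s r \<longleftrightarrow>
    r = (if s x |\<in>| fmdom h then Final (fmupd (s x) (eval F s e) h) s else Fail)"
  by (auto elim!: exec.cases intro: exec.intros)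

lemma exec_Alloc_iff [simp]:
  "exec F (Alloc x e) h s r \<longleftrightarrow>
    (\<exists>n. n |\<notin>| fmdom h \<and> r = Final (fmupd n (eval F s e) h) (s(x := n)))"
  by (auto elim!: exec.cases intro: exec.intros)

lemma exec_Dispose_iff [simp]:
  "exec F (Dispose x) h s r \<longleftrightarrow>
    r = (if s x |\<in>| fmdom h then Final (fmdrop (s x) h) s else Fail)"
  by (auto elim!: exec.cases intro: exec.intros)

lemma exec_HUpdate_iff [simp]:
  "exec F (HUpdate x e) h s r \<longleftrightarrow> r = Final (fmupd (s x) (eval F s e) h) s"
  by (auto elim!: exec.cases intro: exec.intros)

lemma exec_HClear_iff [simp]:
  "exec F (HClear x) h s r \<longleftrightarrow> r = Final (fmdrop (s x) h) s"
  by (auto elim!: exec.cases intro: exec.intros)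

section \<open>Stores that agree on the occurring variables are indistinguishable\<close>

lemma exec_Fail_cong:
  assumes "\<And>x. x \<in> ivars S \<Longrightarrow> s x = t x"
  shows "exec F S h s Fail \<longleftrightarrow> exec F S h t Fail"
proof (cases S)
  case (Lookup x e)
  then have "eval F s e = eval F t e"
    using assms by (auto intro!: eval_cong)
  then show ?thesis
    using Lookup by (simp split: option.split)
qed (use assms in simp_all)

text \<open>The run from \<open>t\<close> repeats the one from \<open>s\<close>, with the same
  location chosen in an allocation. The set \<open>V\<close> carries the agreement over to the
  variables of the assertion that follows a box.\<close>

lemma exec_Final_cong:
  assumes "exec F S h s (Final h' s')" and "\<And>x. x \<in> ivars S \<union> V \<Longrightarrow> s x = t x"
  shows "\<exists>t'. exec F S h t (Final h' t') \<and> (\<forall>x \<in> V. s' x = t' x)"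
proof -
  have ev: "eval F s e = eval F t e" if "vars e \<subseteq> ivars S" for e
    using assms(2) that by (intro eval_cong) auto
  show ?thesis
  proof (cases S)
    case (Assign x e)
    then have "eval F s e = eval F t e" by (intro ev) auto
    with Assign show ?thesis using assms by auto
  next
    case (Lookup x e)
    then have "eval F s e = eval F t e" by (intro ev) auto
    with Lookup show ?thesis using assms by (auto split: option.splits)
  next
    case (Mutate x e)
    then have "eval F s e = eval F t e" by (intro ev) auto
    with Mutate show ?thesis using assms by (auto split: if_splits)
  next
    case (Alloc x e)
    then have "eval F s e = eval F t e" by (intro ev) auto
    with Alloc show ?thesis using assms by fastforce
  next
    case (HUpdate x e)
    then have "eval F s e = eval F t e" by (intro ev) auto
    with HUpdate show ?thesis using assms by auto
  qed (use assms in \<open>auto split: if_splits\<close>)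
qed

text \<open>The heap and both stores vary in the induction, since quantifiers and boxes change the
  store while separating connectives and boxes change the heap.\<close>

lemma sat_cong:
  "(\<And>x. x \<in> avars p \<Longrightarrow> s x = t x) \<Longrightarrow> sat F R h s p \<longleftrightarrow> sat F R h t p"
proof (induction p arbitrary: h s t)
  case (ABool b)
  then show ?case using beval_cong[of b s t] by auto
next
  case (APts e e')
  then have "eval F s e = eval F t e" "eval F s e' = eval F t e'"
    by (auto intro!: eval_cong)
  then show ?case by simp
next
  case (AImp p q)
  from AImp.IH(1)[of s t] AImp.IH(2)[of s t] AImp.prems show ?case by simp
next
  case (AAll x p)
  have "sat F R h (s(x := n)) p \<longleftrightarrow> sat F R h (t(x := n)) p" for n
    using AAll.prems by (intro AAll.IH) auto
  then show ?case by simp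
next
  case (ASep p q)
  from ASep.IH(1)[of s t] ASep.IH(2)[of s t] ASep.prems show ?case by simp
next
  case (AWand p q)
  from AWand.IH(1)[of s t] AWand.IH(2)[of s t] AWand.prems show ?case by simp
next
  case (ABox S p)
  \<comment> \<open>The hypothesis is symmetric in the two stores, so one implication is enough; it
    is used in both directions below.\<close>
  have "sat F R h t (ABox S p)"
    if agree: "\<And>x. x \<in> ivars S \<union> avars p \<Longrightarrow> s x = t x" and "sat F R h s (ABox S p)" for s t
  proof -
    have "sat F R h' t' p" if t': "exec F S h t (Final h' t')" for h' t'
    proof -
      \<comment> \<open>The run from \<open>t\<close> is carried back to one from \<open>s\<close>,
        where the box can be applied.\<close>
      obtain s' where s': "exec F S h s (Final h' s')" "\<And>x. x \<in> avars p \<Longrightarrow> s' x = t' x"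
        using exec_Final_cong[of F S h t h' t' "avars p" s] t' agree by metis
      with \<open>sat F R h s (ABox S p)\<close> ABox.IH[of s' t' h'] show ?thesis
        by simp
    qed
    then show ?thesis
      using that exec_Fail_cong[of S s t F h] by auto
  qed
  from this[of s t] this[of t s] ABox.prems show ?case
    by (metis avars.simps(7))
qed

lemma sat_upd [simp]: "y \<notin> avars p \<Longrightarrow> sat F R h (s(y := n)) p \<longleftrightarrow> sat F R h s p"
  by (rule sat_cong) auto

lemma sat_upd2:
  "y \<notin> avars p \<Longrightarrow> sat F R h (s(y := m, x := n)) p \<longleftrightarrow> sat F R h (s(x := n)) p"
  by (rule sat_cong) auto

section \<open>Meaning of the derived connectives\<close>

lemma sat_AAnd [simp]: "sat F R h s (AAnd p q) \<longleftrightarrow> sat F R h s p \<and> sat F R h s q"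
  by (simp add: AAnd_def ANot_def)

lemma sat_AEx [simp]: "sat F R h s (AEx x p) \<longleftrightarrow> (\<exists>n. sat F R h (s(x := n)) p)"
  by (simp add: AEx_def ANot_def)

lemma sat_ANot [simp]: "sat F R h s (ANot p) \<longleftrightarrow> \<not> sat F R h s p"
  by (simp add: ANot_def)

lemma sat_AEq [simp]: "sat F R h s (AEq e e') \<longleftrightarrow> eval F s e = eval F s e'"
  by (simp add: AEq_def)

lemma sat_AAlloc [simp]: "sat F R h s (AAlloc e) \<longleftrightarrow> eval F s e |\<in>| fmdom h"
proof -
  obtain y where "y \<notin> vars e"
    using finite_vars ex_fresh by metis
  \<comment> \<open>Once some fresh variable exists, the least one is fresh too, so the quantifier
    in \<open>AAlloc\<close> captures nothing in \<open>e\<close>.\<close>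
  then have "(LEAST z. z \<notin> vars e) \<notin> vars e"
    by (rule LeastI)
  then show ?thesis
    by (simp add: AAlloc_def Let_def fmlookup_dom_iff)
qed

section \<open>Exactness of the axioms\<close>

text \<open>Read from right to left this gives the soundness of an axiom for terminating runs, from
  left to right the strength of its postcondition. In each case an initial state is rebuilt from the
  final one.\<close>

lemma sp_axiom_exact:
  assumes "sp_axiom p S q"
  shows "sat F R h' s' q \<longleftrightarrow> (\<exists>h s. sat F R h s p \<and> exec F S h s (Final h' s'))"
  using assms
proof cases
  case (Assign y x e)
  have "(\<exists>n. sat F R h' (s'(x := n)) p \<and> s' x = eval F (s'(x := n)) e) \<longleftrightarrow>
    (\<exists>h s. sat F R h s p \<and> exec F (instr.Assign x e) h s (Final h' s'))" (is "?L \<longleftrightarrow> ?R")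
  proof
    assume ?L
    then obtain n where n: "sat F R h' (s'(x := n)) p" "s' x = eval F (s'(x := n)) e" by blast
    then have "exec F (instr.Assign x e) h' (s'(x := n)) (Final h' s')"
      \<comment> \<open>Reversed, \<open>n(2)\<close> turns the assigned value into
        \<open>s' x\<close>, which restores \<open>s'\<close>.\<close>
      by (simp flip: n(2))
    with n show ?R by blast
  next
    assume ?R
    then obtain s where "sat F R h' s p" "s' = s(x := eval F s e)" by auto
    \<comment> \<open>The right guess is the overwritten value of \<open>x\<close>: putting it back
      gives \<open>s\<close>.\<close>
    then show ?L by (intro exI[of _ "s x"]) simp
  qed
  with Assign show ?thesis
    by (simp add: eval_subst_fresh sat_upd2)
next
  case (Lookup y x e p0)
  have "(\<exists>n. sat F R h' (s'(x := n)) p0 \<and> fmlookup h' (eval F (s'(x := n)) e) = Some (s' x)) \<longleftrightarrow>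
    (\<exists>h s. sat F R h s p \<and> exec F (instr.Lookup x e) h s (Final h' s'))" (is "?L \<longleftrightarrow> ?R")
  proof
    assume ?L
    then obtain n where n: "sat F R h' (s'(x := n)) p0"
      "fmlookup h' (eval F (s'(x := n)) e) = Some (s' x)" by blast
    then have "exec F (instr.Lookup x e) h' (s'(x := n)) (Final h' s')"
      by simp
    with n show ?R
      unfolding \<open>p = _\<close> by (intro exI[of _ h'] exI[of _ "s'(x := n)"]) (simp add: fmdomI)
  next
    assume ?R
    then obtain s v where "sat F R h' s p0" "fmlookup h' (eval F s e) = Some v" "s' = s(x := v)"
      unfolding \<open>p = _\<close> by (auto split: option.splits)
    then show ?L by (intro exI[of _ "s x"]) simp
  qed
  with Lookup show ?thesis
    by (simp add: eval_subst_fresh sat_upd2)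
next
  case (Mutate y x e p0)
  have "(\<exists>n. sat F R (fmupd (s' x) n h') s' p0) \<and> fmlookup h' (s' x) = Some (eval F s' e) \<longleftrightarrow>
    (\<exists>h s. sat F R h s p \<and> exec F (instr.Mutate x e) h s (Final h' s'))" (is "?L \<longleftrightarrow> ?R")
  proof
    assume ?L
    then obtain n where n: "sat F R (fmupd (s' x) n h') s' p0"
      "fmlookup h' (s' x) = Some (eval F s' e)" by blast
    \<comment> \<open>The second write hides the guess and stores what \<open>h'\<close> already
      holds there.\<close>
    then have "fmupd (s' x) (eval F s' e) (fmupd (s' x) n h') = h'"
      by (intro fmap_ext) auto
    with n show ?R
      unfolding \<open>p = _\<close> by (intro exI[of _ "fmupd (s' x) n h'"] exI[of _ s']) simp
  next
    assume ?R
    then obtain h where h: "sat F R h s' p0" "s' x |\<in>| fmdom h" "h' = fmupd (s' x) (eval F s' e) h"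
      unfolding \<open>p = _\<close> by (auto split: if_splits)
    \<comment> \<open>The content destroyed by the mutation is the guess that recovers
      \<open>h\<close>.\<close>
    then obtain v where "fmlookup h (s' x) = Some v" by (auto simp: fmlookup_dom_iff)
    then have "fmupd (s' x) v h' = h"
      using h by (intro fmap_ext) auto
    then have "sat F R (fmupd (s' x) v h') s' p0"
      using h(1) by simp
    with h(3) show ?L by auto
  qed
  with Mutate show ?thesis
    by simp
next
  case (Alloc x e)
  have "(\<exists>n. sat F R (fmdrop (s' x) h') (s'(x := n)) p) \<and> fmlookup h' (s' x) = Some (eval F s' e) \<longleftrightarrow>
    (\<exists>h s. sat F R h s p \<and> exec F (instr.Alloc x e) h s (Final h' s'))" (is "?L \<longleftrightarrow> ?R")
  proof
    assume ?L
    then obtain n where n: "sat F R (fmdrop (s' x) h') (s'(x := n)) p"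
      "fmlookup h' (s' x) = Some (eval F s' e)" by blast
    then have "h' = fmupd (s' x) (eval F s' e) (fmdrop (s' x) h')"
      by (intro fmap_ext) auto
    \<comment> \<open>The location chosen is \<open>s' x\<close>, which has just been cleared; as
      \<open>x\<close> is not in \<open>e\<close>, the written value is the same in both
      stores.\<close>
    then have "exec F (instr.Alloc x e) (fmdrop (s' x) h') (s'(x := n)) (Final h' s')"
      using \<open>x \<notin> vars e\<close> by (auto intro!: exI[of _ "s' x"])
    with n show ?R by blast
  next
    assume ?R
    then obtain h s m where h: "sat F R h s p" "m |\<notin>| fmdom h"
      "h' = fmupd m (eval F s e) h" "s' = s(x := m)"
      by auto
    \<comment> \<open>Since \<open>m\<close> was outside the domain of \<open>h\<close>, clearing it
      undoes the allocation.\<close>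
    then have "fmdrop m h' = h"
      by (intro fmap_ext) auto
    with h \<open>x \<notin> vars e\<close> show ?L by (auto intro!: exI[of _ "s x"])
  qed
  with Alloc show ?thesis
    by simp
next
  case (Dispose y x p0)
  have "(\<exists>n. sat F R (fmupd (s' x) n h') s' p0) \<and> s' x |\<notin>| fmdom h' \<longleftrightarrow>
    (\<exists>h s. sat F R h s p \<and> exec F (instr.Dispose x) h s (Final h' s'))" (is "?L \<longleftrightarrow> ?R")
  proof
    assume ?L
    then obtain n where n: "sat F R (fmupd (s' x) n h') s' p0" "s' x |\<notin>| fmdom h'" by blast
    \<comment> \<open>Here \<open>s' x\<close> is unallocated in \<open>h'\<close>, so clearing it
      removes exactly the guessed cell.\<close>
    then have "fmdrop (s' x) (fmupd (s' x) n h') = h'"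
      by (intro fmap_ext) auto
    with n show ?R
      unfolding \<open>p = _\<close> by (intro exI[of _ "fmupd (s' x) n h'"] exI[of _ s']) simp
  next
    assume ?R
    then obtain h where h: "sat F R h s' p0" "s' x |\<in>| fmdom h" "h' = fmdrop (s' x) h"
      unfolding \<open>p = _\<close> by (auto split: if_splits)
    then obtain v where "fmlookup h (s' x) = Some v" by (auto simp: fmlookup_dom_iff)
    then have "fmupd (s' x) v h' = h"
      using h by (intro fmap_ext) auto
    then have "sat F R (fmupd (s' x) v h') s' p0"
      using h(1) by simp
    with h(3) show ?L by auto
  qed
  with Dispose show ?thesis
    by simp
qed

text \<open>Exactness says nothing about failing runs. They are excluded by the allocation conjunct
  in the preconditions for lookup, mutation and disposal.\<close>

lemma sp_axiom_safe:
  assumes "sp_axiom p S q" and "sat F R h s p"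
  shows "\<not> exec F S h s Fail"
  using assms by cases (auto split: option.splits simp: fmlookup_dom_iff)

text \<open>If \<open>S\<close> cannot fail from \<open>p\<close>, then \<open>p\<close> already
  implies the allocation conjunct that an axiom may require, so adding it does not change the
  meaning of \<open>p\<close>.\<close>

lemma sp_axiom_applies:
  assumes "basic S" and "\<And>x e. S = Alloc x e \<Longrightarrow> x \<notin> vars e"
    and safe: "\<And>h s. sat F R h s p \<Longrightarrow> \<not> exec F S h s Fail"
  obtains p' q' where "sp_axiom p' S q'" and "\<And>h s. sat F R h s p' \<longleftrightarrow> sat F R h s p"
proof -
  have "finite (ivars S \<union> avars p)"
    by (simp add: finite_ivars finite_avars)
  then obtain y where y: "y \<notin> ivars S \<union> avars p"
    by (rule ex_fresh)
  show thesis
  proof (cases S)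
    case (Assign x e)
    with y have "y \<notin> insert x (vars e \<union> avars p)"
      by simp
    from that[OF sp_axiom.Assign[OF this, folded Assign]] show thesis
      by simp
  next
    case (Lookup x e)
    show thesis
    proof (rule that)
      show "sp_axiom (AAnd p (AAlloc e)) S
          (AEx y (AAnd (ABox (Assign x (Var y)) p) (subst e y x \<hookrightarrow> Var x)))"
        using Lookup y by (auto intro!: sp_axiom.Lookup)
      show "sat F R h s (AAnd p (AAlloc e)) \<longleftrightarrow> sat F R h s p" for h s
        using Lookup safe[of h s] by (auto split: option.splits intro: fmdomI)
    qed
  next
    case (Mutate x e)
    show thesis
    proof (rule that)
      show "sp_axiom (AAnd p (AAlloc (Var x))) S
          (AAnd (AEx y (ABox (HUpdate x (Var y)) p)) (Var x \<hookrightarrow> e))"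
        using Mutate y by (auto intro!: sp_axiom.Mutate)
      show "sat F R h s (AAnd p (AAlloc (Var x))) \<longleftrightarrow> sat F R h s p" for h s
        using Mutate safe[of h s] by (auto split: if_splits)
    qed
  next
    case (Alloc x e)
    from that[OF sp_axiom.Alloc[OF assms(2)[OF this], folded Alloc]] show thesis
      by simp
  next
    case (Dispose x)
    show thesis
    proof (rule that)
      show "sp_axiom (AAnd p (AAlloc (Var x))) S
          (AAnd (AEx y (ABox (HUpdate x (Var y)) p)) (ANot (AAlloc (Var x))))"
        using Dispose y by (auto intro!: sp_axiom.Dispose)
      show "sat F R h s (AAnd p (AAlloc (Var x))) \<longleftrightarrow> sat F R h s p" for h s
        using Dispose safe[of h s] by (auto split: if_splits)
    qed
  qed (use \<open>basic S\<close> in simp_all)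
qed

theorem theorem4p2:
  fixes F :: "'f \<Rightarrow> int list \<Rightarrow> int"
    and R :: "'r \<Rightarrow> int list \<Rightarrow> bool"
    and S :: "'f instr"
    and p q :: "('f, 'r) assn"
  assumes "basic S"
    and "\<And>x e. S = Alloc x e \<Longrightarrow> x \<notin> vars e"
  shows "hoare_valid F R p S q \<longleftrightarrow> derivable F R p S q"
proof
  assume valid_p: "hoare_valid F R p S q"
  then have "\<And>h s. sat F R h s p \<Longrightarrow> \<not> exec F S h s Fail"
    by (simp add: hoare_valid_def)
  with assms obtain p' q' where ax: "sp_axiom p' S q'"
    and p': "\<And>h s. sat F R h s p' \<longleftrightarrow> sat F R h s p"
    by (rule sp_axiom_applies) auto
  have "valid F R (AImp p p')"
    by (simp add: valid_def p')
  \<comment> \<open>By exactness a state satisfying \<open>q'\<close> is reached from one satisfying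
    \<open>p\<close>, and the valid triple then gives \<open>q\<close>.\<close>
  moreover have "valid F R (AImp q' q)"
    using valid_p by (auto simp: valid_def hoare_valid_def sp_axiom_exact[OF ax] p')
  ultimately show "derivable F R p S q"
    using ax by (blast intro: derivable.consequence)
next
  assume "derivable F R p S q"
  then obtain p' q' where ax: "sp_axiom p' S q'"
    and "valid F R (AImp p p')" "valid F R (AImp q' q)"
    by (auto elim: derivable.cases)
  then have p': "\<And>h s. sat F R h s p \<Longrightarrow> sat F R h s p'"
    and q': "\<And>h s. sat F R h s q' \<Longrightarrow> sat F R h s q"
    by (auto simp: valid_def)
  show "hoare_valid F R p S q"
    unfolding hoare_valid_def using sp_axiom_safe[OF ax] sp_axiom_exact[OF ax] p' q' by blast
qed

end
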